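(* Let $a>0$, $b>0$ be given constants. Consider, for $\lambda>0$, the problem (the case $p=2$) $$-(b+a\Vert u'\Vert^2)\,u''(x)=\lambda u(x)^2,\ x\in I,\qquad u(x)>0,\ x\in I,\qquad u(\pm1)=0, \qquad ( * )$$ on $I=(-1,1)$. (i) Let $\lambda=2\sqrt{ab}\,Q_2$. Then $( * )$ has a unique solution $u_\lambda(x)=2b\lambda^{-1}W_2(x)$. Moreover, $\xi:=\Vert u_\lambda\Vert_\infty$ satisfies $$\xi=2bQ_1\lambda^{-1}=\sqrt{\frac{b}{a}}\,\frac{Q_1}{Q_2}.$$ (ii) Let $\lambda>2\sqrt{ab}\,Q_2$. Then there exist exactly two solutions $u_{\lambda,1}$ and $u_{\lambda,2}$ of $( * )$. Moreover, their maximum norms $\xi_1=\xi_1(\lambda)=\Vert u_{\lambda,1}\Vert_\infty$ and $\xi_2=\xi_2(\lambda)=\Vert u_{\lambda,2}\Vert_\infty$ are parameterized by $\lambda$ and represented as $$\xi_1(\lambda)=\frac{\lambda Q_2^{-1}+\sqrt{\lambda^2Q_2^{-2}-4ab}}{2a}\,Q_2^{-1}Q_1,\qquad \xi_2(\lambda)=\frac{\lambda Q_2^{-1}-\sqrt{\lambda^2Q_2^{-2}-4ab}}{2a}\,Q_2^{-1}Q_1.$$ (iii) Let $0<\lambda<2\sqrt{ab}\,Q_2$. Then there are no solutions of $( * )$.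
   Context: $I:=(-1,1)$, $\Vert u'\Vert:=\left(\int_I u'(x)^2\,dx\right)^{1/2}$, and $\Vert\cdot\Vert_\infty$ is the maximum norm on $\bar I$. Solutions are classical, i.e. $u\in C^2(\bar I)$; the parameter $\lambda$ is always positive. The constants are $$A_2:=\int_0^1\frac{1}{\sqrt{1-s^3}}\,ds,\quad B_2:=\int_0^1\sqrt{1-s^3}\,ds,\quad Q_1:=\frac32A_2^2,\quad Q_2:=\frac{3}{\sqrt2}A_2^{5/2}B_2^{1/2}.$$ $W_2$ denotes the unique solution (known to exist and be unique) of $-W''(x)=W(x)^2$ and $W(x)>0$ for $x\in I$, $W(-1)=W(1)=0$. *)

theory Defs
  imports "HOL-Analysis.Analysis"
begin

text \<open>
  A function on the closed interval \<open>[-1,1]\<close> is represented by its extension by zero to the whole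
  line, so that equality of solutions (and hence the counting of solutions) is plain equality of
  HOL functions. All derivatives are taken within \<open>[-1,1]\<close>, i.e. they are one-sided at \<open>\<plusminus>1\<close>, and
  thus do not depend on this extension.
\<close>

definition zero_outside :: "(real \<Rightarrow> real) \<Rightarrow> bool" where
  "zero_outside u \<longleftrightarrow> (\<forall>x. x \<notin> {-1..1} \<longrightarrow> u x = 0)"

definition D :: "(real \<Rightarrow> real) \<Rightarrow> real \<Rightarrow> real" where
  "D u x = vector_derivative u (at x within {-1..1})"

definition C2 :: "(real \<Rightarrow> real) \<Rightarrow> bool" where
  "C2 u \<longleftrightarrow> u differentiable_on {-1..1} \<and> D u differentiable_on {-1..1} \<and>
            continuous_on {-1..1} (D (D u))"

definition L2_norm_I :: "(real \<Rightarrow> real) \<Rightarrow> real" where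
  "L2_norm_I f = sqrt (integral {-1..1} (\<lambda>x. (f x)\<^sup>2))"

definition max_norm :: "(real \<Rightarrow> real) \<Rightarrow> real" where
  "max_norm u = (SUP x\<in>{-1..1}. \<bar>u x\<bar>)"

text \<open>The integrand of \<open>A2\<close> is singular at \<open>1\<close>, where division by zero gives the value \<open>0\<close>.\<close>

definition A2 :: real where
  "A2 = integral {0..1} (\<lambda>s. 1 / sqrt (1 - s ^ 3))"

definition B2 :: real where
  "B2 = integral {0..1} (\<lambda>s. sqrt (1 - s ^ 3))"

definition Q1 :: real where
  "Q1 = 3 / 2 * A2\<^sup>2"

definition Q2 :: real where
  "Q2 = 3 / sqrt 2 * A2 powr (5 / 2) * B2 powr (1 / 2)"

definition local_solution :: "(real \<Rightarrow> real) \<Rightarrow> bool" where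
  "local_solution W \<longleftrightarrow> zero_outside W \<and> C2 W \<and>
     (\<forall>x\<in>{-1<..<1}. - D (D W) x = (W x)\<^sup>2) \<and>
     (\<forall>x\<in>{-1<..<1}. W x > 0) \<and> W (-1) = 0 \<and> W 1 = 0"

definition W2 :: "real \<Rightarrow> real" where
  "W2 = (THE W. local_solution W)"

definition kirchhoff_solution :: "real \<Rightarrow> real \<Rightarrow> real \<Rightarrow> (real \<Rightarrow> real) \<Rightarrow> bool" where
  "kirchhoff_solution a b l u \<longleftrightarrow> zero_outside u \<and> C2 u \<and>
     (\<forall>x\<in>{-1<..<1}. - (b + a * (L2_norm_I (D u))\<^sup>2) * D (D u) x = l * (u x)\<^sup>2) \<and>
     (\<forall>x\<in>{-1<..<1}. u x > 0) \<and> u (-1) = 0 \<and> u 1 = 0"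

end

theory Submission
  imports Defs
begin

text \<open>
  Scaling \<open>u = t W\<^sub>2\<close> turns the nonlocal problem into \<open>a \<parallel>W\<^sub>2'\<parallel>\<^sup>2 t\<^sup>2 - \<lambda> t + b = 0\<close>, so everything
  rests on \<open>W\<^sub>2\<close> having maximum \<open>Q\<^sub>1\<close> and \<open>\<parallel>W\<^sub>2'\<parallel> = Q\<^sub>2\<close>. The local problem is solved by its
  energy \<open>W'\<^sup>2 / 2 + W\<^sup>3 / 3 = M\<^sup>3 / 3\<close>. The substitution \<open>W = M (1 - r\<^sup>2)\<close>, with \<open>r\<close> negative before
  and positive after the maximum, makes the time map smooth across the maximum: \<open>r\<close> is the inverse
  of an increasing function \<open>H\<close> up to scaling, and the boundary conditions \<open>r (\<plusminus>1) = \<plusminus>1\<close> fix the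
  position of the maximum and \<open>M\<close>.
\<close>

subsection \<open>Derivatives within the interval\<close>

lemma D_eqI:
  assumes "(u has_real_derivative d) (at x within {-1..1})" "x \<in> {-1..1}"
  shows "D u x = d"
  unfolding D_def
  using assms by (intro vector_derivative_within_closed_interval)
    (auto simp: has_real_derivative_iff_has_vector_derivative)

lemma D_works:
  assumes "u differentiable_on {-1..1}" "x \<in> {-1..1}"
  shows "(u has_real_derivative D u x) (at x within {-1..1})"
  using assms unfolding D_def has_real_derivative_iff_has_vector_derivative differentiable_on_def
  by (simp flip: vector_derivative_works)

lemma C2_derivs:
  assumes "C2 u" "x \<in> {-1..1}"
  shows "(u has_real_derivative D u x) (at x within {-1..1})"
    and "(D u has_real_derivative D (D u) x) (at x within {-1..1})"
  using assms D_works by (auto simp: C2_def)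

text \<open>The way to verify \<open>C2\<close> from explicit formulas. \<open>D u\<close> and
  \<open>v\<close> agree only on the interval, which suffices because every derivative is taken
  within it.\<close>

lemma C2I:
  assumes u: "\<And>x. x \<in> {-1..1} \<Longrightarrow> (u has_real_derivative v x) (at x within {-1..1})"
    and v: "\<And>x. x \<in> {-1..1} \<Longrightarrow> (v has_real_derivative w x) (at x within {-1..1})"
    and w: "continuous_on {-1..1} w"
  shows "C2 u" and "\<And>x. x \<in> {-1..1} \<Longrightarrow> D u x = v x" and "\<And>x. x \<in> {-1..1} \<Longrightarrow> D (D u) x = w x"
proof -
  show Du: "D u x = v x" if "x \<in> {-1..1}" for x
    using D_eqI u that by blast
  have Dv: "(D u has_real_derivative w x) (at x within {-1..1})" if "x \<in> {-1..1}" for x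
    using v[OF that] by (rule has_field_derivative_transform_within[where d=1]) (use that Du in auto)
  show DD: "D (D u) x = w x" if "x \<in> {-1..1}" for x
    using D_eqI Dv that by blast
  have "continuous_on {-1..1} (D (D u))"
    using w by (subst continuous_on_cong[OF refl DD])
  then show "C2 u"
    using u Dv unfolding C2_def differentiable_on_def real_differentiable_def
    by (meson has_field_derivative_imp_has_derivative differentiableI)
qed

lemma C2_scale:
  assumes "C2 u"
  shows "C2 (\<lambda>x. k * u x)"
    and "\<And>x. x \<in> {-1..1} \<Longrightarrow> D (\<lambda>x. k * u x) x = k * D u x"
    and "\<And>x. x \<in> {-1..1} \<Longrightarrow> D (D (\<lambda>x. k * u x)) x = k * D (D u) x"
proof -
  have c: "continuous_on {-1..1} (\<lambda>x. k * D (D u) x)"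
    using assms by (auto simp: C2_def intro: continuous_intros)
  note * = C2I[OF _ _ c, of "\<lambda>x. k * u x" "\<lambda>x. k * D u x"]
  show "C2 (\<lambda>x. k * u x)"
    by (rule *) (auto intro!: DERIV_cmult C2_derivs assms)
  show "D (\<lambda>x. k * u x) x = k * D u x" if "x \<in> {-1..1}" for x
    by (rule *) (use that in \<open>auto intro!: DERIV_cmult C2_derivs assms\<close>)
  show "D (D (\<lambda>x. k * u x)) x = k * D (D u) x" if "x \<in> {-1..1}" for x
    by (rule *) (use that in \<open>auto intro!: DERIV_cmult C2_derivs assms\<close>)
qed

lemma L2_norm_I_scale:
  assumes "C2 u"
  shows "(L2_norm_I (D (\<lambda>x. k * u x)))\<^sup>2 = k\<^sup>2 * (L2_norm_I (D u))\<^sup>2"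
proof -
  have "continuous_on {-1..1} (D u)"
    by (rule DERIV_continuous_on) (rule C2_derivs(2)[OF assms])
  then have i: "(\<lambda>x. (D u x)\<^sup>2) integrable_on {-1..1}"
    by (intro integrable_continuous_interval continuous_intros)
  have "integral {-1..1} (\<lambda>x. (D (\<lambda>x. k * u x) x)\<^sup>2) = integral {-1..1} (\<lambda>x. k\<^sup>2 * (D u x)\<^sup>2)"
    by (rule integral_cong) (simp add: C2_scale[OF assms] power_mult_distrib)
  then show ?thesis
    by (simp add: L2_norm_I_def integral_nonneg[OF i] integral_nonneg mult_nonneg_nonneg i)
qed

subsection \<open>The regularised quarter period\<close>

text \<open>The oriented integral gives the correct sign for negative \<open>x\<close>, so this is
  an antiderivative on the whole line.\<close>

definition antideriv :: "(real \<Rightarrow> real) \<Rightarrow> real \<Rightarrow> real" where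
  "antideriv f x = (LBINT y=0..x. f y)"

lemma antideriv_0 [simp]: "antideriv f 0 = 0"
  by (simp add: antideriv_def zero_ereal_def[symmetric])

lemma DERIV_antideriv:
  assumes "continuous_on UNIV f"
  shows "(antideriv f has_real_derivative f x) (at x)"
proof -
  \<comment> \<open>Both 0 and \<open>x\<close> are interior points of this interval, so the
    derivative within it is the full derivative.\<close>
  let ?a = "min 0 x - 1" and ?b = "max 0 x + 1"
  have "((\<lambda>u. LBINT y=0..u. f y) has_vector_derivative f x) (at x within {?a..?b})"
    using interval_integral_FTC2[of ?a 0 ?b f x] continuous_on_subset[OF assms]
    by (simp add: zero_ereal_def)
  then have "(antideriv f has_real_derivative f x) (at x within {?a..?b})"
    by (simp add: has_real_derivative_iff_has_vector_derivative antideriv_def[abs_def])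
  then show ?thesis
    by (subst (asm) at_within_Icc_at) auto
qed

text \<open>Evenness of \<open>f\<close> cancels the derivative of
  \<open>antideriv f x + antideriv f (- x)\<close>, and this sum is 0 at the origin.\<close>

lemma antideriv_even_minus:
  assumes c: "continuous_on UNIV f" and even: "\<And>x. f (- x) = f x"
  shows "antideriv f (- x) = - antideriv f x"
proof -
  have "((\<lambda>x. antideriv f x + antideriv f (- x)) has_real_derivative 0) (at x)" for x
    by (auto intro!: derivative_eq_intros DERIV_antideriv[OF c] DERIV_chain2[OF DERIV_antideriv[OF c]]
        simp: even)
  then have "antideriv f x + antideriv f (- x) = antideriv f 0 + antideriv f (- 0)"
    by (intro DERIV_isconst_all) blast
  then show ?thesis by simp
qed

text \<open>With \<open>s = 1 - r\<^sup>2\<close> one has \<open>1 - s\<^sup>3 = (r * q r)\<^sup>2\<close>, so that the square root singularity of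
  the integrand of A2 disappears and \<open>r\<close> may change sign.\<close>

definition q :: "real \<Rightarrow> real" where
  "q r = sqrt (3 - 3 * r\<^sup>2 + r ^ 4)"

lemma q_radicand_pos: "3 - 3 * r\<^sup>2 + r ^ 4 > (0::real)"
proof -
  have "3 - 3 * r\<^sup>2 + r ^ 4 = (r\<^sup>2 - 3 / 2)\<^sup>2 + 3 / 4"
    by (simp add: power2_eq_square power4_eq_xxxx algebra_simps)
  then show ?thesis by (simp add: add_nonneg_pos)
qed

lemma q_pos [simp]: "q r > 0"
  by (simp add: q_def q_radicand_pos)

lemma q_nonzero [simp]: "q r \<noteq> 0"
  using q_pos[of r] by linarith

lemma q_squared: "(q r)\<^sup>2 = 3 - 3 * r\<^sup>2 + r ^ 4"
  using q_radicand_pos[of r] by (simp add: q_def)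

lemma q_minus [simp]: "q (- r) = q r"
  by (simp add: q_def)

lemma DERIV_q: "(q has_real_derivative (2 * r ^ 3 - 3 * r) / q r) (at r)"
  unfolding q_def[abs_def] using q_radicand_pos[of r]
  by (auto intro!: derivative_eq_intros simp: field_simps)

lemma continuous_on_q: "continuous_on S q"
  by (meson DERIV_q DERIV_isCont continuous_at_imp_continuous_on)

lemma one_minus_cube: "1 - (1 - r\<^sup>2) ^ 3 = (r * q r)\<^sup>2"
  unfolding power_mult_distrib q_squared by (simp add: eval_nat_numeral algebra_simps)

text \<open>The substitution \<open>r = sqrt (1 - s)\<close>, done through the primitive
  \<open>- antideriv f (sqrt (1 - s))\<close>. The primitive is continuous up to
  \<open>s = 1\<close> and needs a derivative only in the interior, so the singularity at 1 is
  harmless.\<close>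

lemma has_integral_sqrt_substitution:
  assumes c: "continuous_on UNIV f"
  shows "((\<lambda>s. f (sqrt (1 - s)) / (2 * sqrt (1 - s))) has_integral antideriv f 1) {0..1}"
proof -
  have cont: "continuous_on UNIV (antideriv f)"
    by (rule DERIV_continuous_on) (use DERIV_antideriv[OF c] in auto)
  let ?F = "\<lambda>s. - antideriv f (sqrt (1 - s))"
  have "((\<lambda>s. f (sqrt (1 - s)) / (2 * sqrt (1 - s))) has_integral ?F 1 - ?F 0) {0..1}"
  proof (rule fundamental_theorem_of_calculus_interior)
    show "continuous_on {0..1} ?F"
      by (intro continuous_intros continuous_on_compose2[OF cont]) auto
    fix s :: real assume "s \<in> {0<..<1}"
    then show "(?F has_vector_derivative f (sqrt (1 - s)) / (2 * sqrt (1 - s))) (at s)"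
      unfolding has_real_derivative_iff_has_vector_derivative[symmetric]
      by (auto intro!: derivative_eq_intros DERIV_chain2[OF DERIV_antideriv[OF c]] simp: field_simps)
  qed simp
  then show ?thesis by simp
qed

text \<open>For \<open>r \<ge> 0\<close> this is the integral of \<open>1 / sqrt (1 - s ^ 3)\<close>
  over \<open>s\<close> from \<open>1 - r\<^sup>2\<close> to 1, that is, the time map;
  \<open>L\<close> below is its analogue for \<open>sqrt (1 - s ^ 3)\<close>. Both continue as odd
  functions to negative \<open>r\<close>.\<close>

definition H :: "real \<Rightarrow> real" where
  "H = antideriv (\<lambda>r. 2 / q r)"

definition L :: "real \<Rightarrow> real" where
  "L = antideriv (\<lambda>r. 2 * r\<^sup>2 * q r)"

lemma continuous_on_H_integrand: "continuous_on S (\<lambda>r. 2 / q r)"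
  by (intro continuous_intros continuous_on_q) simp

lemma continuous_on_L_integrand: "continuous_on S (\<lambda>r. 2 * r\<^sup>2 * q r)"
  by (intro continuous_intros continuous_on_q)

lemma DERIV_H: "(H has_real_derivative 2 / q r) (at r)"
  unfolding H_def by (rule DERIV_antideriv[OF continuous_on_H_integrand])

lemma DERIV_L: "(L has_real_derivative 2 * r\<^sup>2 * q r) (at r)"
  unfolding L_def by (rule DERIV_antideriv[OF continuous_on_L_integrand])

lemma H_minus: "H (- r) = - H r"
  unfolding H_def by (rule antideriv_even_minus[OF continuous_on_H_integrand]) simp

lemma L_minus: "L (- r) = - L r"
  unfolding L_def by (rule antideriv_even_minus[OF continuous_on_L_integrand]) simp

lemma sqrt_one_minus_cube:
  assumes "s \<in> {0..1}"
  shows "sqrt (1 - s ^ 3) = sqrt (1 - s) * q (sqrt (1 - s))"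
  using assms one_minus_cube[of "sqrt (1 - s)"] by (simp add: real_sqrt_unique less_imp_le)

lemma A2_eq: "A2 = H 1"
proof -
  \<comment> \<open>At \<open>s = 1\<close> both integrands are 0 by division by zero.\<close>
  have "A2 = integral {0..1} (\<lambda>s. 2 / q (sqrt (1 - s)) / (2 * sqrt (1 - s)))"
    unfolding A2_def by (rule integral_cong) (simp add: sqrt_one_minus_cube)
  also have "\<dots> = H 1"
    unfolding H_def
    by (rule integral_unique[OF has_integral_sqrt_substitution[OF continuous_on_H_integrand]])
  finally show ?thesis .
qed

lemma B2_eq: "B2 = L 1"
proof -
  have "B2 = integral {0..1} (\<lambda>s. 2 * (sqrt (1 - s))\<^sup>2 * q (sqrt (1 - s)) / (2 * sqrt (1 - s)))"
    unfolding B2_def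
  proof (rule integral_cong)
    \<comment> \<open>True also for \<open>r = 0\<close> by division by zero, which covers
      \<open>s = 1\<close>.\<close>
    have "r = 2 * r\<^sup>2 / (2 * r)" for r :: real by (simp add: power2_eq_square)
    then show "sqrt (1 - s ^ 3) = 2 * (sqrt (1 - s))\<^sup>2 * q (sqrt (1 - s)) / (2 * sqrt (1 - s))"
      if "s \<in> {0..1}" for s
      unfolding sqrt_one_minus_cube[OF that] by (metis times_divide_eq_left)
  qed
  also have "\<dots> = L 1"
    unfolding L_def
    by (rule integral_unique[OF has_integral_sqrt_substitution[OF continuous_on_L_integrand]])
  finally show ?thesis .
qed

lemma H_strict_mono: "strict_mono H"
proof (rule strict_monoI)
  fix x y :: real assume "x < y"
  then show "H x < H y"
    by (rule DERIV_pos_imp_increasing) (meson DERIV_H divide_pos_pos q_pos zero_less_numeral)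
qed

lemma A2_pos: "A2 > 0"
  using strict_monoD[OF H_strict_mono, of 0 1] by (simp add: A2_eq H_def)

lemma B2_pos: "B2 > 0"
proof -
  have "L 0 < L 1"
  \<comment> \<open>The derivative of \<open>L\<close> vanishes at 0, so positivity is only
    available in the open interval.\<close>
  proof (rule DERIV_pos_imp_increasing_open[where f=L])
    show "\<exists>y. (L has_real_derivative y) (at x) \<and> y > 0" if "0 < x" "x < 1" for x
      by (intro exI conjI, rule DERIV_L) (use that in simp)
    show "continuous_on {0..1} L"
      using DERIV_L by (meson DERIV_isCont continuous_at_imp_continuous_on)
  qed simp
  then show ?thesis by (simp add: B2_eq L_def)
qed

lemma Q1_pos: "Q1 > 0"
  using A2_pos by (simp add: Q1_def)

lemma Q2_pos: "Q2 > 0"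
  using A2_pos B2_pos by (simp add: Q2_def)

text \<open>Grouped in the form in which the integral of the squared derivative of the explicit
  solution arises, namely \<open>Q1\<^sup>2 * A2\<close> times \<open>L 1 - L (-1)\<close>.\<close>

lemma Q2_squared: "Q2\<^sup>2 = 2 * (Q1\<^sup>2 * A2) * B2"
proof -
  have "(A2 powr (5 / 2))\<^sup>2 = A2 ^ 5" "(B2 powr (1 / 2))\<^sup>2 = B2"
    using A2_pos B2_pos by (simp_all add: powr_power)
  then show ?thesis
    by (simp add: Q2_def Q1_def power_mult_distrib power_divide eval_nat_numeral)
qed

subsection \<open>The solution of the local problem\<close>

text \<open>Scaled by \<open>A2 = H 1\<close> so that \<open>R\<close> fixes -1 and 1. The value is
  meaningful only where \<open>A2 * x\<close> lies in the range of \<open>H\<close>; on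
  \<open>[-1,1]\<close> the intermediate value theorem ensures this.\<close>

definition R :: "real \<Rightarrow> real" where
  "R x = inv H (A2 * x)"

lemma R_eq: "H r = A2 * x \<Longrightarrow> R x = r"
  by (simp add: R_def inv_f_eq strict_mono_imp_inj_on[OF H_strict_mono])

lemma R_exists:
  assumes "x \<in> {-1..1}"
  obtains r where "r \<in> {-1..1}" "H r = A2 * x"
proof -
  have "H (-1) \<le> A2 * x" "A2 * x \<le> H 1"
    using assms A2_pos mult_left_mono[of "-1" x A2] by (auto simp: H_minus A2_eq[symmetric])
  then show ?thesis
    using IVT[of H "-1" "A2 * x" 1] that DERIV_isCont[OF DERIV_H] by force
qed

lemma H_R: "x \<in> {-1..1} \<Longrightarrow> H (R x) = A2 * x"
  using R_exists R_eq by metis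

lemma R_minus_1: "R (-1) = -1" and R_1: "R 1 = 1"
  by (auto intro!: R_eq simp: H_minus A2_eq)

lemma R_0: "R 0 = 0"
  by (auto intro!: R_eq simp: H_def)

lemma R_bounds:
  assumes "x \<in> {-1<..<1}"
  shows "-1 < R x" "R x < 1"
proof -
  have "H (-1) < H (R x)" "H (R x) < H 1"
    using assms A2_pos mult_strict_left_mono[of "-1" x A2] by (auto simp: H_R H_minus A2_eq[symmetric])
  then show "-1 < R x" "R x < 1"
    by (simp_all add: strict_mono_less[OF H_strict_mono])
qed

lemma DERIV_R:
  assumes "x \<in> {-1..1}"
  shows "(R has_real_derivative A2 * q (R x) / 2) (at x)"
proof -
  define r where "r = R x"
  have r: "H r = A2 * x" using H_R[OF assms] by (simp add: r_def)
  have inj: "inj H" by (rule strict_mono_imp_inj_on[OF H_strict_mono])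
  have cH: "isCont H z" for z using DERIV_isCont[OF DERIV_H] .
  have "(inv H has_real_derivative inverse (2 / q r)) (at (H r))"
  \<comment> \<open>The window reaches beyond \<open>H r\<close> on both sides even for
    \<open>x = 1\<close> and \<open>x = -1\<close>, so the derivative of \<open>R\<close> there is
    two-sided.\<close>
  proof (rule DERIV_inverse_function[where f=H and a="H (r - 1)" and b="H (r + 1)"])
    show "(H has_real_derivative 2 / q r) (at (inv H (H r)))"
      using DERIV_H inj by simp
    show "isCont (inv H) (H r)"
      by (rule isCont_inverse_function2[of "r - 1" _ "r + 1"]) (use inj cH in auto)
    show "H (inv H y) = y" if y: "H (r - 1) < y" "y < H (r + 1)" for y
    proof -
      obtain z where "H z = y"
        using IVT[of H "r - 1" y "r + 1"] y cH by force
      then show ?thesis by (auto intro: f_inv_into_f)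
    qed
  qed (use strict_monoD[OF H_strict_mono] in auto)
  then have "((\<lambda>x. inv H (A2 * x)) has_real_derivative inverse (2 / q r) * A2) (at x)"
    unfolding r by (rule DERIV_chain2) (auto intro!: derivative_eq_intros)
  then show ?thesis
    unfolding R_def[abs_def, symmetric] r_def[symmetric] by (simp add: mult.commute)
qed

definition W0 :: "real \<Rightarrow> real" where
  "W0 x = (if x \<in> {-1..1} then Q1 * (1 - (R x)\<^sup>2) else 0)"

text \<open>Since \<open>R' = A2 * q R / 2\<close>, the factor \<open>q\<close> cancels in the
  derivative of \<open>R * q R\<close>, leaving \<open>A2 / 2 * 3 * (1 - R\<^sup>2)\<^sup>2\<close>.
  The value \<open>Q1 = 3 / 2 * A2\<^sup>2\<close> is exactly what turns the remaining constant into
  \<open>Q1\<^sup>2\<close>.\<close>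

lemma W0_derivs:
  shows "C2 W0"
    and "\<And>x. x \<in> {-1..1} \<Longrightarrow> D W0 x = - Q1 * A2 * (R x * q (R x))"
    and "\<And>x. x \<in> {-1..1} \<Longrightarrow> D (D W0) x = - (W0 x)\<^sup>2"
proof -
  let ?v = "\<lambda>x. - Q1 * A2 * (R x * q (R x))"
  have W: "(W0 has_real_derivative ?v x) (at x within {-1..1})" if x: "x \<in> {-1..1}" for x
  proof -
    have "((\<lambda>x. Q1 * (1 - (R x)\<^sup>2)) has_real_derivative ?v x) (at x within {-1..1})"
      by (auto intro!: derivative_eq_intros DERIV_subset[OF DERIV_R] x)
    then show ?thesis
      by (rule has_field_derivative_transform_within[where d=1]) (use x in \<open>auto simp: W0_def\<close>)
  qed
  have v: "(?v has_real_derivative - (W0 x)\<^sup>2) (at x within {-1..1})" if x: "x \<in> {-1..1}" for x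
  proof -
    let ?r = "R x"
    have "((\<lambda>x. R x * q (R x)) has_real_derivative
        ?r * ((2 * ?r ^ 3 - 3 * ?r) / q ?r * (A2 * q ?r / 2)) + A2 * q ?r / 2 * q ?r) (at x within {-1..1})"
      by (rule DERIV_mult'[OF DERIV_subset[OF DERIV_R[OF x]] DERIV_chain2[OF DERIV_q DERIV_subset[OF DERIV_R[OF x]]]]) auto
    also have "?r * ((2 * ?r ^ 3 - 3 * ?r) / q ?r * (A2 * q ?r / 2)) + A2 * q ?r / 2 * q ?r
        = A2 / 2 * (?r * (2 * ?r ^ 3 - 3 * ?r) + (q ?r)\<^sup>2)"
      by (simp add: field_simps power2_eq_square)
    also have "\<dots> = A2 / 2 * (3 * (1 - ?r\<^sup>2)\<^sup>2)"
      unfolding q_squared by (simp add: eval_nat_numeral algebra_simps)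
    finally have "(?v has_real_derivative - Q1 * A2 * (A2 / 2 * (3 * (1 - ?r\<^sup>2)\<^sup>2))) (at x within {-1..1})"
      by (rule DERIV_cmult)
    moreover have "- Q1 * A2 * (A2 / 2 * (3 * (1 - ?r\<^sup>2)\<^sup>2)) = - (W0 x)\<^sup>2"
      using x by (simp add: W0_def Q1_def power2_eq_square)
    ultimately show ?thesis by simp
  qed
  have c: "continuous_on {-1..1} (\<lambda>x. - (W0 x)\<^sup>2)"
    by (intro continuous_intros DERIV_continuous_on[OF W])
  show "C2 W0" by (rule C2I[OF W v c])
  show "D W0 x = ?v x" if "x \<in> {-1..1}" for x by (rule C2I(2)[OF W v c that])
  show "D (D W0) x = - (W0 x)\<^sup>2" if "x \<in> {-1..1}" for x by (rule C2I(3)[OF W v c that])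
qed

lemma local_solution_W0: "local_solution W0"
  unfolding local_solution_def
proof (intro conjI ballI)
  fix x :: real assume x: "x \<in> {-1<..<1}"
  show "- D (D W0) x = (W0 x)\<^sup>2" using x by (simp add: W0_derivs)
  show "W0 x > 0"
    using x R_bounds[OF x] Q1_pos abs_square_less_1[of "R x"] by (simp add: W0_def)
qed (auto simp: zero_outside_def W0_derivs W0_def R_1 R_minus_1)

lemma max_norm_scaled_W0:
  assumes "t \<ge> 0"
  shows "max_norm (\<lambda>x. t * W0 x) = t * Q1"
  unfolding max_norm_def
proof (rule cSup_eq_maximum)
  show "t * Q1 \<in> (\<lambda>x. \<bar>t * W0 x\<bar>) ` {-1..1}"
    using assms Q1_pos by (intro image_eqI[of _ _ 0]) (auto simp: W0_def R_0)
  fix y assume "y \<in> (\<lambda>x. \<bar>t * W0 x\<bar>) ` {-1..1}"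
  then obtain x where x: "x \<in> {-1..1}" "y = \<bar>t * W0 x\<bar>" by auto
  have "\<bar>R x\<bar> \<le> 1"
    using x(1) R_bounds[of x] R_1 R_minus_1 by (cases "x = 1 \<or> x = -1") auto
  then have "0 \<le> 1 - (R x)\<^sup>2" "1 - (R x)\<^sup>2 \<le> 1" by (auto simp: abs_square_le_1)
  then have "0 \<le> W0 x" "W0 x \<le> Q1"
    using Q1_pos x(1) by (auto simp: W0_def mult_left_le)
  then show "y \<le> t * Q1" using x assms by (simp add: mult_left_mono)
qed

text \<open>The squared derivative of \<open>W0\<close> is the derivative of
  \<open>Q1\<^sup>2 * A2 * L (R x)\<close>, and oddness of \<open>L\<close> makes the increment of
  \<open>L (R x)\<close> over the interval \<open>2 * B2\<close>.\<close>

lemma L2_norm_W0: "(L2_norm_I (D W0))\<^sup>2 = Q2\<^sup>2"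
proof -
  have "((\<lambda>x. Q1\<^sup>2 * A2 * (2 * (R x)\<^sup>2 * q (R x) * (A2 * q (R x) / 2))) has_integral
      Q1\<^sup>2 * A2 * L (R 1) - Q1\<^sup>2 * A2 * L (R (-1))) {-1..1}"
    by (rule fundamental_theorem_of_calculus,
        simp,
        unfold has_real_derivative_iff_has_vector_derivative[symmetric],
        rule DERIV_cmult[OF DERIV_chain2[OF DERIV_L DERIV_subset[OF DERIV_R]]])
      auto
  then have "((\<lambda>x. (D W0 x)\<^sup>2) has_integral Q2\<^sup>2) {-1..1}"
    unfolding R_1 R_minus_1 L_minus Q2_squared B2_eq
    by (subst has_integral_cong[where g="\<lambda>x. Q1\<^sup>2 * A2 * (2 * (R x)\<^sup>2 * q (R x) * (A2 * q (R x) / 2))"])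
      (auto simp: W0_derivs power2_eq_square algebra_simps)
  then show ?thesis
    by (simp add: L2_norm_I_def integral_unique)
qed

text \<open>The variable \<open>r\<close> is recovered from an arbitrary solution and shown to
  satisfy \<open>H (r x) = k * (x - c)\<close>. The two boundary conditions then determine
  \<open>c\<close> and \<open>k\<close>, hence the maximum and the whole solution.\<close>

lemma local_solution_unique:
  assumes "local_solution W"
  shows "W = W0"
proof -
  define V where "V = D W"
  have C2: "C2 W" and zero: "zero_outside W" and W1: "W (-1) = 0" "W 1 = 0"
    and ode: "\<And>x. x \<in> {-1<..<1} \<Longrightarrow> D V x = - (W x)\<^sup>2"
    and pos: "\<And>x. x \<in> {-1<..<1} \<Longrightarrow> W x > 0"
    using assms by (force simp: local_solution_def V_def)+
  have cW: "continuous_on {-1..1} W" and cV: "continuous_on {-1..1} V"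
    using DERIV_continuous_on[OF C2_derivs(1)[OF C2]] DERIV_continuous_on[OF C2_derivs(2)[OF C2]]
    by (auto simp: V_def)
  have dW: "(W has_real_derivative V x) (at x)" if "x \<in> {-1<..<1}" for x
    using C2_derivs(1)[OF C2, of x] that at_within_Icc_at[of "-1" x 1] by (simp add: V_def)
  have dV: "(V has_real_derivative - (W x)\<^sup>2) (at x)" if "x \<in> {-1<..<1}" for x
    using C2_derivs(2)[OF C2, of x] that at_within_Icc_at[of "-1" x 1] ode[OF that]
    by (simp add: V_def)
  \<comment> \<open>Rolle's theorem supplies a critical point; the strict decrease of
    \<open>V\<close> proved next makes it the only one.\<close>
  obtain c where c: "-1 < c" "c < 1" "V c = 0"
  proof -
    have "\<exists>z>-1. z < 1 \<and> (\<lambda>h. V z * h) = (\<lambda>v. 0)"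
      by (rule Rolle_deriv[OF _ _ cW]) (use W1 dW in \<open>auto simp: has_field_derivative_def\<close>)
    then show ?thesis using that by (metis mult.right_neutral)
  qed
  define M where "M = W c"
  have M: "M > 0" using pos c by (simp add: M_def)
  have V_less: "V y < V x" if "-1 \<le> x" "x < y" "y \<le> 1" for x y
  proof (rule DERIV_neg_imp_decreasing_open[OF that(2)])
    show "\<exists>d. (V has_real_derivative d) (at z) \<and> d < 0" if "x < z" "z < y" for z
      using dV[of z] pos[of z] that \<open>-1 \<le> x\<close> \<open>y \<le> 1\<close>
      by (intro exI[of _ "- (W z)\<^sup>2"]) auto
    show "continuous_on {x..y} V" by (rule continuous_on_subset[OF cV]) (use that in auto)
  qed
  \<comment> \<open>Conservation of energy, with the level read off at \<open>c\<close>, where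
    \<open>V\<close> vanishes.\<close>
  have energy: "(V x)\<^sup>2 = 2 / 3 * (M ^ 3 - (W x) ^ 3)" if "x \<in> {-1..1}" for x
  proof -
    let ?E = "\<lambda>x. (V x)\<^sup>2 / 2 + (W x) ^ 3 / 3"
    have "?E y = ?E (-1)" if "y \<in> {-1..1}" for y
    proof (rule DERIV_isconst2[of "-1" 1])
      show "continuous_on {-1..1} ?E" by (intro continuous_intros cW cV) auto
      fix x :: real assume "-1 < x" "x < 1"
      then have x: "x \<in> {-1<..<1}" by simp
      show "(?E has_real_derivative 0) (at x)"
        by (auto intro!: derivative_eq_intros dW[OF x] dV[OF x] simp: power2_eq_square)
    qed (use that in auto)
    from this[OF that] this[of c] c show ?thesis by (simp add: M_def)
  qed
  have W_le: "W x \<le> M" if "x \<in> {-1..1}" for x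
  proof -
    have "W x ^ 3 \<le> M ^ 3"
      using zero_le_power2[of "V x"] unfolding energy[OF that] by simp
    then show ?thesis using power_strict_mono[of M "W x" 3] M by linarith
  qed
  \<comment> \<open>Strictness keeps the radicand of \<open>r\<close> positive away from
    \<open>c\<close>, so that \<open>r\<close> can be differentiated there.\<close>
  have W_less: "W x < M" if "x \<in> {-1..1}" "x \<noteq> c" for x
  proof -
    have "V x \<noteq> 0" using V_less[of x c] V_less[of c x] c that by (cases "x < c") auto
    then have "(V x)\<^sup>2 > 0" by simp
    then have "W x \<noteq> M" using energy[OF that(1)] by auto
    with W_le[OF that(1)] show ?thesis by simp
  qed
  \<comment> \<open>Solves \<open>W = M * (1 - r\<^sup>2)\<close> with the sign of
    \<open>x - c\<close>.\<close>
  define r where "r = (\<lambda>x. if x \<le> c then - sqrt (1 - W x / M) else sqrt (1 - W x / M))"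
  have r2: "(r x)\<^sup>2 = 1 - W x / M" if "x \<in> {-1..1}" for x
    using W_le[OF that] M by (simp add: r_def)
  \<comment> \<open>Chosen so that the energy law reads
    \<open>(V x)\<^sup>2 = (k * M * (r x * q (r x)))\<^sup>2\<close>.\<close>
  define k where "k = sqrt (2 * M / 3)"
  have k: "k > 0" "k\<^sup>2 = 2 * M / 3" using M by (simp_all add: k_def)
  \<comment> \<open>Energy fixes \<open>V\<close> up to sign. As \<open>V\<close> decreases through
    0 at \<open>c\<close>, its sign is opposite to that of \<open>r\<close>.\<close>
  have V_eq: "V x = - (k * M * (r x * q (r x)))" (is "_ = - ?y") if x: "x \<in> {-1..1}" for x
  proof -
    have "W x = M * (1 - (r x)\<^sup>2)" using r2[OF x] M by (simp add: field_simps)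
    then have "W x ^ 3 = M ^ 3 * (1 - (r x)\<^sup>2) ^ 3"
      by (simp only: power_mult_distrib)
    then have "M ^ 3 - W x ^ 3 = M ^ 3 * (1 - (1 - (r x)\<^sup>2) ^ 3)"
      by (simp only: right_diff_distrib mult_1_right)
    then have "(V x)\<^sup>2 = 2 / 3 * (M ^ 3 * (r x * q (r x))\<^sup>2)"
      unfolding energy[OF x] one_minus_cube by simp
    also have "\<dots> = ?y\<^sup>2"
      unfolding power_mult_distrib k by (simp add: power2_eq_square power3_eq_cube)
    finally have *: "V x = ?y \<or> V x = - ?y" by (simp add: power2_eq_iff)
    show ?thesis
    proof (cases "x \<le> c")
      case True
      then have "V x \<ge> 0" "r x \<le> 0"
        using V_less[of x c] c x W_le[OF x] M by (cases "x = c"; force simp: r_def)+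
      moreover from this have "?y \<le> 0"
        using k(1) M less_imp_le[OF q_pos, of "r x"] by (intro mult_nonneg_nonpos mult_nonpos_nonneg) auto
      ultimately show ?thesis using * by linarith
    next
      case False
      then have "V x \<le> 0" "r x \<ge> 0"
        using V_less[of c x] c x W_le[OF x] M by (force simp: r_def)+
      moreover from this have "?y \<ge> 0"
        using k(1) M less_imp_le[OF q_pos, of "r x"] by simp
      ultimately show ?thesis using * by linarith
    qed
  qed
  have dr: "(r has_real_derivative k * q (r x) / 2) (at x)" if x: "x \<in> {-1<..<1}" "x \<noteq> c" for x
  proof -
    have s: "1 - W x / M > 0" using W_less[of x] x M by simp
    have V: "V x = - (k * M * (r x * q (r x)))" using V_eq[of x] x by simp
    have d: "((\<lambda>x. sqrt (1 - W x / M)) has_real_derivative - V x / (2 * M * sqrt (1 - W x / M))) (at x)"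
      using s M by (auto intro!: derivative_eq_intros dW x simp: field_simps)
    show ?thesis
    proof (cases "x < c")
      case True
      have "((\<lambda>x. - sqrt (1 - W x / M)) has_real_derivative k * q (r x) / 2) (at x)"
        using DERIV_minus[OF d] True s M unfolding V by (simp add: r_def)
      then show ?thesis
        by (rule has_field_derivative_transform_within_open[where S="{..<c}"])
          (use True in \<open>auto simp: r_def\<close>)
    next
      case False
      have "((\<lambda>x. sqrt (1 - W x / M)) has_real_derivative k * q (r x) / 2) (at x)"
        using d False x s M unfolding V by (simp add: r_def)
      then show ?thesis
        by (rule has_field_derivative_transform_within_open[where S="{c<..}"])
          (use False x in \<open>auto simp: r_def\<close>)
    qed
  qed
  have cr: "continuous_on {-1..1} r"
    unfolding r_def
    by (rule continuous_on_cases_le)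
      (use M in \<open>auto intro!: continuous_intros continuous_on_subset[OF cW] simp: M_def\<close>)
  have cH: "continuous_on UNIV H"
    by (rule DERIV_continuous_on) (use DERIV_H in auto)
  \<comment> \<open>By \<open>H' = 2 / q\<close> and \<open>r' = k * q r / 2\<close>, the
    composition \<open>H (r x)\<close> has slope \<open>k\<close>. Differentiability of
    \<open>r\<close> was not established at \<open>c\<close> and the end points; continuity bridges
    these finitely many points.\<close>
  have const: "H (r x) - k * (x - c) = H (r (-1)) - k * (-1 - c)" if "x \<in> {-1..1}" for x
  proof (rule has_derivative_zero_unique_strong_interval[where
        f="\<lambda>x. H (r x) - k * (x - c)" and k="{-1, c, 1}" and a="-1" and b=1])
    show "continuous_on {-1..1} (\<lambda>x. H (r x) - k * (x - c))"
      by (intro continuous_intros continuous_on_compose2[OF cH cr]) auto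
    fix x :: real assume "x \<in> {-1..1} - {-1, c, 1}"
    then have x: "x \<in> {-1<..<1}" "x \<noteq> c" by auto
    have "((\<lambda>x. H (r x) - k * (x - c)) has_real_derivative 2 / q (r x) * (k * q (r x) / 2) - k) (at x)"
      by (rule DERIV_diff[OF DERIV_chain2[OF DERIV_H dr[OF x]]]) (auto intro!: derivative_eq_intros)
    then have "((\<lambda>x. H (r x) - k * (x - c)) has_real_derivative 0) (at x)"
      by simp
    then show "((\<lambda>x. H (r x) - k * (x - c)) has_derivative (\<lambda>h. 0)) (at x within {-1..1})"
      by (auto simp: has_field_derivative_def lambda_zero intro: has_derivative_at_withinI)
  qed (use that in auto)
  have rc: "r c = 0" using M by (simp add: r_def M_def)
  have Hr: "H (r x) = k * (x - c)" if "x \<in> {-1..1}" for x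
    using const[OF that] const[of c] c rc by (simp add: H_def)
  have "r (-1) = -1" "r 1 = 1" using c W1 by (simp_all add: r_def)
  \<comment> \<open>Two equations for \<open>k\<close> and \<open>c\<close>: adding them gives
    \<open>k * c = 0\<close>, so the maximum is at the centre and \<open>k = A2\<close>; the
    definition of \<open>k\<close> then yields \<open>M = Q1\<close>.\<close>
  then have e: "- A2 = k * (-1 - c)" "A2 = k * (1 - c)"
    using Hr[of "-1"] Hr[of 1] by (simp_all add: A2_eq H_minus)
  then have "k * c = 0" unfolding right_diff_distrib by linarith
  then have c0: "c = 0" using k by simp
  with e have kA: "k = A2" by simp
  have MQ: "M = Q1" using k(2) unfolding kA Q1_def by simp
  show "W = W0"
  proof
    fix x
    show "W x = W0 x"
    proof (cases "x \<in> {-1..1}")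
      case True
      then have "R x = r x" using Hr[OF True] by (intro R_eq) (simp add: c0 kA)
      then show ?thesis
        using True r2[OF True] M unfolding MQ by (simp add: W0_def field_simps)
    next
      case False
      then show ?thesis using zero by (auto simp: zero_outside_def W0_def)
    qed
  qed
qed

lemma W2_eq: "W2 = W0"
  unfolding W2_def using local_solution_W0 local_solution_unique by (rule the_equality)

subsection \<open>The nonlocal problem\<close>

text \<open>For a given \<open>u\<close> the nonlocal coefficient is a constant \<open>K\<close>, so
  \<open>l / K * u\<close> solves the local problem and \<open>u = t * W0\<close> with
  \<open>t = K / l\<close>. Inserting this into the definition of \<open>K\<close> gives the
  consistency condition \<open>l * t = b + a * Q2\<^sup>2 * t\<^sup>2\<close>; conversely, this
  condition makes \<open>t * W0\<close> a solution.\<close>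

lemma kirchhoff_solution_iff:
  assumes ab: "a > 0" "b > 0" and l: "l > 0"
  shows "kirchhoff_solution a b l u \<longleftrightarrow>
    (\<exists>t>0. u = (\<lambda>x. t * W0 x) \<and> a * Q2\<^sup>2 * t\<^sup>2 - l * t + b = 0)"
proof
  assume u: "kirchhoff_solution a b l u"
  define K where "K = b + a * (L2_norm_I (D u))\<^sup>2"
  have K: "K > 0" using ab by (simp add: K_def add_pos_nonneg)
  have C2: "C2 u" and zero: "zero_outside u" and ends: "u (-1) = 0" "u 1 = 0"
    and ode: "\<And>x. x \<in> {-1<..<1} \<Longrightarrow> - K * D (D u) x = l * (u x)\<^sup>2"
    and pos: "\<And>x. x \<in> {-1<..<1} \<Longrightarrow> u x > 0"
    using u by (auto simp: kirchhoff_solution_def K_def)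
  have "local_solution (\<lambda>x. l / K * u x)"
    unfolding local_solution_def
  proof (intro conjI ballI)
    fix x :: real assume x: "x \<in> {-1<..<1}"
    show "l / K * u x > 0" using pos[OF x] l K by simp
    have "D (D (\<lambda>x. l / K * u x)) x = l / K * D (D u) x"
      using x by (intro C2_scale C2) auto
    then have "- D (D (\<lambda>x. l / K * u x)) x = l / K\<^sup>2 * (- K * D (D u) x)"
      using K by (simp add: power2_eq_square)
    also have "\<dots> = (l / K * u x)\<^sup>2"
      unfolding ode[OF x] by (simp add: power_mult_distrib power_divide power2_eq_square)
    finally show "- D (D (\<lambda>x. l / K * u x)) x = (l / K * u x)\<^sup>2" .
  qed (use zero ends C2_scale(1)[OF C2, of "l / K"] in \<open>auto simp: zero_outside_def\<close>)
  then have W: "(\<lambda>x. l / K * u x) = W0" by (rule local_solution_unique)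
  define t where "t = K / l"
  have t: "t > 0" using K l by (simp add: t_def)
  have ut: "u = (\<lambda>x. t * W0 x)"
    unfolding W[symmetric] using K l by (simp add: t_def)
  have "(L2_norm_I (D u))\<^sup>2 = t\<^sup>2 * Q2\<^sup>2"
    unfolding ut L2_norm_I_scale[OF W0_derivs(1)] L2_norm_W0 ..
  then have "l * t = b + a * (t\<^sup>2 * Q2\<^sup>2)"
    using l by (simp add: t_def K_def)
  then have "a * Q2\<^sup>2 * t\<^sup>2 - l * t + b = 0" by (simp add: algebra_simps)
  with t ut show "\<exists>t>0. u = (\<lambda>x. t * W0 x) \<and> a * Q2\<^sup>2 * t\<^sup>2 - l * t + b = 0" by blast
next
  assume "\<exists>t>0. u = (\<lambda>x. t * W0 x) \<and> a * Q2\<^sup>2 * t\<^sup>2 - l * t + b = 0"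
  then obtain t where t: "t > 0" and u: "u = (\<lambda>x. t * W0 x)"
    and eq: "a * Q2\<^sup>2 * t\<^sup>2 - l * t + b = 0" by blast
  have "(L2_norm_I (D u))\<^sup>2 = t\<^sup>2 * Q2\<^sup>2"
    unfolding u L2_norm_I_scale[OF W0_derivs(1)] L2_norm_W0 ..
  then have K: "b + a * (L2_norm_I (D u))\<^sup>2 = l * t"
    using eq by (simp add: algebra_simps)
  show "kirchhoff_solution a b l u"
    unfolding kirchhoff_solution_def K unfolding u
    using local_solution_W0 t
    by (auto simp: local_solution_def zero_outside_def C2_scale[OF W0_derivs(1)] W0_derivs(3)
        power2_eq_square)
qed

text \<open>Completing the square after multiplication by \<open>4 * a\<close>, with
  \<open>Q2 * t\<close> as unknown so that the discriminant takes the form in the theorem.\<close>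

lemma scaling_quadratic_iff:
  assumes "a > 0"
  shows "a * Q2\<^sup>2 * t\<^sup>2 - l * t + b = 0 \<longleftrightarrow> (2 * a * Q2 * t - l / Q2)\<^sup>2 = l\<^sup>2 / Q2\<^sup>2 - 4 * a * b"
proof -
  have "(2 * a * Q2 * t - l / Q2)\<^sup>2 - (l\<^sup>2 / Q2\<^sup>2 - 4 * a * b) = 4 * a * (a * Q2\<^sup>2 * t\<^sup>2 - l * t + b)"
    using Q2_pos by (simp add: power2_diff power_divide power_mult_distrib algebra_simps power2_eq_square)
  then show ?thesis using assms by auto
qed

theorem theorem1p4:
  fixes a b l :: real
  assumes "a > 0" and "b > 0" and "l > 0"
  shows "(l = 2 * sqrt (a * b) * Q2 \<longrightarrow>
            (\<exists>!u. kirchhoff_solution a b l u) \<and>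
            (\<forall>u. kirchhoff_solution a b l u \<longrightarrow>
               u = (\<lambda>x. 2 * b / l * W2 x) \<and>
               max_norm u = 2 * b * Q1 / l \<and>
               max_norm u = sqrt (b / a) * (Q1 / Q2)))
       \<and> (l > 2 * sqrt (a * b) * Q2 \<longrightarrow>
            (\<exists>u1 u2. u1 \<noteq> u2 \<and> {u. kirchhoff_solution a b l u} = {u1, u2} \<and>
               max_norm u1 = (l / Q2 + sqrt (l\<^sup>2 / Q2\<^sup>2 - 4 * a * b)) / (2 * a) * (Q1 / Q2) \<and>
               max_norm u2 = (l / Q2 - sqrt (l\<^sup>2 / Q2\<^sup>2 - 4 * a * b)) / (2 * a) * (Q1 / Q2)))
       \<and> (l < 2 * sqrt (a * b) * Q2 \<longrightarrow> \<not> (\<exists>u. kirchhoff_solution a b l u))"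
proof -
  define p where "p = l / Q2"
  define d where "d = l\<^sup>2 / Q2\<^sup>2 - 4 * a * b"
  have Q: "Q2 > 0" "Q1 > 0" by (rule Q2_pos, rule Q1_pos)
  have p: "p > 0" using assms Q by (simp add: p_def)
  \<comment> \<open>The three cases of the theorem are thus the three signs of
    \<open>d\<close>.\<close>
  have dp: "d = p\<^sup>2 - (2 * sqrt (a * b))\<^sup>2"
    using assms by (simp add: d_def p_def power_divide power_mult_distrib)
  have sol: "kirchhoff_solution a b l u \<longleftrightarrow>
      (\<exists>t>0. u = (\<lambda>x. t * W0 x) \<and> (2 * a * Q2 * t - p)\<^sup>2 = d)" for u
    unfolding kirchhoff_solution_iff[OF assms] scaling_quadratic_iff[OF assms(1)] p_def d_def ..
  have "(\<exists>!u. kirchhoff_solution a b l u) \<and>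
            (\<forall>u. kirchhoff_solution a b l u \<longrightarrow>
               u = (\<lambda>x. 2 * b / l * W2 x) \<and>
               max_norm u = 2 * b * Q1 / l \<and>
               max_norm u = sqrt (b / a) * (Q1 / Q2))" if l: "l = 2 * sqrt (a * b) * Q2"
  proof -
    have p_eq: "p = 2 * sqrt (a * b)" using l Q by (simp add: p_def)
    have "d = 0" by (simp add: dp p_eq)
    have sab: "sqrt (a * b) * sqrt (a * b) = a * b" "sqrt (a * b) > 0" using assms by auto
    \<comment> \<open>The double root \<open>p / (2 * a * Q2)\<close> equals
      \<open>2 * b / l\<close> because \<open>p\<^sup>2 = 4 * a * b\<close> and
      \<open>l = p * Q2\<close> at the threshold.\<close>
    have t: "2 * a * Q2 * t - p = 0 \<longleftrightarrow> t = 2 * b / l" for t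
    proof -
      have "2 * a * Q2 * (2 * b / l) = p"
        unfolding l p_eq using sab Q by (simp add: divide_eq_eq)
      moreover have "2 * a * Q2 * t - 2 * a * Q2 * (2 * b / l) = 2 * a * Q2 * (t - 2 * b / l)"
        by (simp add: algebra_simps)
      ultimately show ?thesis using assms Q by auto
    qed
    have s: "kirchhoff_solution a b l u \<longleftrightarrow> u = (\<lambda>x. 2 * b / l * W0 x)" for u
      unfolding sol \<open>d = 0\<close> power_zero_numeral zero_eq_power2 t using assms
      by (auto intro!: exI[of _ "2 * b / l"])
    have c: "2 * b / l = sqrt (b / a) / Q2"
    proof -
      have "sqrt (b / a) * sqrt (a * b) = b"
        using assms by (simp flip: real_sqrt_mult)
      then have "b / sqrt (a * b) = sqrt (b / a)" using sab by (simp add: divide_eq_eq)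
      then have "sqrt (b / a) / Q2 = b / sqrt (a * b) / Q2" by simp
      then show ?thesis unfolding l by simp
    qed
    have m: "max_norm (\<lambda>x. 2 * b / l * W0 x) = 2 * b / l * Q1"
      using assms by (intro max_norm_scaled_W0) simp
    then have "max_norm (\<lambda>x. 2 * b / l * W0 x) = 2 * b * Q1 / l" by simp
    moreover from m have "max_norm (\<lambda>x. 2 * b / l * W0 x) = sqrt (b / a) * (Q1 / Q2)"
      unfolding c by simp
    ultimately show ?thesis unfolding s W2_eq by blast
  qed
  moreover have "\<exists>u1 u2. u1 \<noteq> u2 \<and> {u. kirchhoff_solution a b l u} = {u1, u2} \<and>
               max_norm u1 = (p + sqrt d) / (2 * a) * (Q1 / Q2) \<and>
               max_norm u2 = (p - sqrt d) / (2 * a) * (Q1 / Q2)" if l: "2 * sqrt (a * b) * Q2 < l"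
  proof -
    have "2 * sqrt (a * b) < p" using l Q by (simp add: p_def field_simps)
    then have "(2 * sqrt (a * b))\<^sup>2 < p\<^sup>2" by (rule power_strict_mono) (use assms in auto)
    then have d: "d > 0" by (simp add: dp)
    \<comment> \<open>This makes the smaller root positive as well, so both roots give
      solutions.\<close>
    have "d < p\<^sup>2" using assms by (simp add: dp)
    then have sd: "sqrt d < p" "sqrt d > 0" using p d by (auto simp: real_less_lsqrt)
    define t1 t2 where "t1 = (p + sqrt d) / (2 * a * Q2)" and "t2 = (p - sqrt d) / (2 * a * Q2)"
    have t: "t1 > 0" "t2 > 0" "t1 \<noteq> t2"
      using sd assms Q add_pos_pos[OF p sd(2)] by (auto simp: t1_def t2_def)
    have eq: "(2 * a * Q2 * t - p)\<^sup>2 = d \<longleftrightarrow> t = t1 \<or> t = t2" for t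
    proof -
      have "(2 * a * Q2 * t - p)\<^sup>2 = d \<longleftrightarrow> (2 * a * Q2 * t - p)\<^sup>2 = (sqrt d)\<^sup>2"
        using d by simp
      also have "\<dots> \<longleftrightarrow> t = t1 \<or> t = t2"
        unfolding power2_eq_iff t1_def t2_def using assms Q by (auto simp: field_simps)
      finally show ?thesis .
    qed
    let ?u1 = "\<lambda>x. t1 * W0 x" and ?u2 = "\<lambda>x. t2 * W0 x"
    \<comment> \<open>The two multiples differ at the centre, where \<open>W0\<close> takes the
      nonzero value \<open>Q1\<close>.\<close>
    have "?u1 0 \<noteq> ?u2 0" using t Q by (simp add: W0_def R_0)
    then have "?u1 \<noteq> ?u2" by metis
    moreover have "{u. kirchhoff_solution a b l u} = {?u1, ?u2}"
      unfolding sol eq using t by auto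
    moreover have "max_norm ?u1 = (p + sqrt d) / (2 * a) * (Q1 / Q2)"
      "max_norm ?u2 = (p - sqrt d) / (2 * a) * (Q1 / Q2)"
      using max_norm_scaled_W0[of t1] max_norm_scaled_W0[of t2] t(1,2)
      unfolding t1_def t2_def by auto
    ultimately show ?thesis by blast
  qed
  moreover have "\<not> (\<exists>u. kirchhoff_solution a b l u)" if l: "l < 2 * sqrt (a * b) * Q2"
  proof -
    have "p < 2 * sqrt (a * b)" using l Q by (simp add: p_def field_simps)
    then have "p\<^sup>2 < (2 * sqrt (a * b))\<^sup>2" by (rule power_strict_mono) (use p in auto)
    then have "d < 0" by (simp add: dp)
    then show ?thesis unfolding sol by (metis not_less zero_le_power2)
  qed
  ultimately show ?thesis unfolding p_def d_def by blast
qed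

end
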